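(* Let $R_0$ be a finitely generated integral domain with infinitely many pairwise non-associate prime elements, let $R = R_0[s,t]$ be the polynomial ring in two variables over $R_0$, and let $F$ be the field of fractions of $R$. Let $\Gamma$ be a group with $SL_2(R) \leq \Gamma \leq SL_2(F)$. Then $\Gamma$ is not finitely generated.
   Context: An integral domain is called finitely generated if it is finitely generated as a $\mathbb{Z}$-algebra (i.e. as a ring). *)

theory Defs
  imports
    "HOL-Analysis.Determinants"
    "HOL-Computational_Algebra.Computational_Algebra"
    "HOL-Algebra.Generated_Groups"
    "HOL-Algebra.Generated_Rings"
    "HOL-Algebra.Algebraic_Closure_Type"
begin

text \<open>
  Integral domains are types of class \<open>idom\<close>. The bridge \<open>ring_of_type_algebra\<close> turns such a type
  into a HOL-Algebra record with carrier \<open>UNIV\<close>; \<open>generate_ring\<close> yields the subring generated by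
  a set, that is, the subalgebra it generates over the integers.
\<close>

definition finitely_generated_ring :: "('a, 'b) ring_scheme \<Rightarrow> bool" where
  "finitely_generated_ring R \<longleftrightarrow>
     (\<exists>S. finite S \<and> S \<subseteq> carrier R \<and> generate_ring R S = carrier R)"

definition finitely_generated_group :: "('a, 'b) monoid_scheme \<Rightarrow> bool" where
  "finitely_generated_group G \<longleftrightarrow>
     (\<exists>S. finite S \<and> S \<subseteq> carrier G \<and> generate G S = carrier G)"

text \<open>
  The class \<open>idom\<close> carries no normalisation function, so being associate is expressed by mutual
  divisibility.
\<close>

definition associates :: "'a::comm_semiring_1 \<Rightarrow> 'a \<Rightarrow> bool" where
  "associates a b \<longleftrightarrow> a dvd b \<and> b dvd a"

lemma associates_iff_unit_multiple:
  fixes a b :: "'a::idom"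
  shows "associates a b \<longleftrightarrow> (\<exists>u. u dvd 1 \<and> b = u * a)"
proof
  assume "associates a b"
  then obtain u v where u: "b = a * u" and v: "a = b * v"
    unfolding associates_def by (meson dvdE)
  show "\<exists>u. u dvd 1 \<and> b = u * a"
  proof (cases "a = 0")
    case True
    then show ?thesis using u by (intro exI[of _ 1]) auto
  next
    case False
    have "a * (u * v) = a * 1" using u v by (simp add: mult.assoc[symmetric])
    then have "u * v = 1" using False mult_cancel_left by blast
    then have "u dvd 1" by (metis dvdI)
    then show ?thesis using u by (intro exI[of _ u]) (simp add: mult.commute)
  qed
next
  assume "\<exists>u. u dvd 1 \<and> b = u * a"
  then obtain u where "u dvd 1" and b: "b = u * a" by blast
  then obtain v where "1 = u * v" by (meson dvdE)
  with b have "a = b * v" by (metis mult.commute mult.left_commute mult_1)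
  then show "associates a b" unfolding associates_def using b by (metis dvd_triv_left dvd_triv_right)
qed

definition SL2 :: "('a::comm_ring_1 ^ 2 ^ 2) monoid" where
  "SL2 = \<lparr>carrier = {A. det A = 1}, mult = (**), one = mat 1\<rparr>"

lemma group_SL2: "group (SL2 :: ('a::comm_ring_1 ^ 2 ^ 2) monoid)"
proof (rule groupI)
  fix A :: "'a ^ 2 ^ 2"
  assume "A \<in> carrier SL2"
  then have d: "A$1$1 * A$2$2 - A$1$2 * A$2$1 = 1"
    by (simp add: SL2_def det_2)
  define B :: "'a ^ 2 ^ 2" where
    "B = (\<chi> i j. if i = j then (if i = 1 then A$2$2 else A$1$1) else - (A$i$j))"
  have "det B = 1" "B ** A = mat 1"
    using d by (auto simp: B_def det_2 matrix_matrix_mult_def sum_2 vec_eq_iff forall_2 mat_def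
        algebra_simps)
  then show "\<exists>B\<in>carrier SL2. B \<otimes>\<^bsub>SL2\<^esub> A = \<one>\<^bsub>SL2\<^esub>"
    by (auto simp: SL2_def)
qed (auto simp: SL2_def det_mul matrix_mul_assoc)

text \<open>
  The copy of \<open>SL2\<close> over a domain inside \<open>SL2\<close> over its field of fractions: entrywise image under
  the canonical embedding \<open>to_fract\<close>.
\<close>

definition SL2_in_fract :: "('a::idom fract ^ 2 ^ 2) set" where
  "SL2_in_fract = map_matrix to_fract ` carrier SL2"

lemma subgroup_SL2_in_fract:
  "subgroup (SL2_in_fract :: ('a::idom fract ^ 2 ^ 2) set) SL2"
proof -
  have "map_matrix to_fract \<in> hom (SL2 :: ('a ^ 2 ^ 2) monoid) SL2"
    by (auto simp: hom_def SL2_def det_2 matrix_matrix_mult_def sum_2 vec_eq_iff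
        simp flip: to_fract_add to_fract_mult to_fract_diff)
  then have "group_hom (SL2 :: ('a ^ 2 ^ 2) monoid) SL2 (map_matrix to_fract)"
    by (simp add: group_hom_def group_hom_axioms_def group_SL2)
  then show ?thesis
    unfolding SL2_in_fract_def by (rule group_hom.img_is_subgroup)
qed

end

theory Submission
  imports Defs
begin

text \<open>
  Suppose \<open>\<Gamma>\<close> is finitely generated. Then \<open>\<Gamma>\<close> lies in \<open>SL2\<close> of \<open>R[1/f]\<close> for some \<open>f \<noteq> 0\<close>. As \<open>R\<^sub>0\<close> is
  noetherian, some prime \<open>p\<close> of \<open>R\<^sub>0\<close> does not divide the leading coefficient of \<open>f\<close>. Give \<open>s\<close> weight
  \<open>1\<close> and \<open>t\<close> a weight \<open>N\<close> so large that \<open>f\<close> has a single monomial of top weight, let \<open>\<nu>\<close> be the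
  exponential of the weighted degree on \<open>F\<close>, and put \<open>h = t - s ^ N\<close>.

  For \<open>P\<close> in \<open>\<Gamma>\<close> let \<open>(a, b) = (p, h) P\<close>. Comparing the first two coefficients in the expansions of
  \<open>a\<close> and \<open>b\<close> in powers of \<open>h\<close> modulo \<open>p\<close>, the equation \<open>det P = 1\<close> forces \<open>\<nu> a * \<nu> b \<ge> 1\<close>.
  In terms of the tree of \<open>\<nu>\<close>, the orbit of \<open>\<Gamma>\<close> avoids a horoball centred at the end \<open>h / p\<close>.
  A path of bounded steps that avoids this horoball cannot realise a long translation along
  the horosphere, whereas \<open>\<Gamma>\<close> contains the unipotents \<open>1 + r (h, -p)\<^sup>T (p, h)\<close> for all \<open>r\<close> in \<open>R\<close>.
\<close>

no_notation fps_nth (infixl \<open>$\<close> 75)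

section \<open>Finitely generated groups acting on non-archimedean planes\<close>

text \<open>Elements are read as words in the generators and their inverses, so that an invariant
  has to be checked only under right multiplication by finitely many elements.\<close>

lemma generated_group_word_induct:
  assumes "group H" "finitely_generated_group H"
  obtains G where "finite G" "G \<subseteq> carrier H"
    "\<And>Q x. Q \<one>\<^bsub>H\<^esub> \<Longrightarrow> (\<And>x g. x \<in> carrier H \<Longrightarrow> g \<in> G \<Longrightarrow> Q x \<Longrightarrow> Q (x \<otimes>\<^bsub>H\<^esub> g))
       \<Longrightarrow> x \<in> carrier H \<Longrightarrow> Q x"
proof -
  interpret group H by fact
  obtain S where S: "finite S" "S \<subseteq> carrier H" "generate H S = carrier H"
    using assms(2) by (auto simp: finitely_generated_group_def)
  define G where "G = S \<union> (\<lambda>g. inv\<^bsub>H\<^esub> g) ` S"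
  \<comment> \<open>The starting point \<open>x\<close> stays arbitrary: a product of two generated
    elements first moves \<open>x\<close> and then its image.\<close>
  have right: "Q (x \<otimes>\<^bsub>H\<^esub> g)"
    if step: "\<And>x g. x \<in> carrier H \<Longrightarrow> g \<in> G \<Longrightarrow> Q x \<Longrightarrow> Q (x \<otimes>\<^bsub>H\<^esub> g)"
      and g: "g \<in> generate H S" and x: "x \<in> carrier H" "Q x" for Q x g
    using g x
  proof (induction arbitrary: x)
    case (eng h1 h2)
    then show ?case using S(3) by (metis m_assoc m_closed)
  qed (auto intro!: step simp: G_def)
  show thesis
  proof (rule that)
    show "finite G" "G \<subseteq> carrier H" using S by (auto simp: G_def)
    show "Q x" if "Q \<one>\<^bsub>H\<^esub>" "\<And>x g. x \<in> carrier H \<Longrightarrow> g \<in> G \<Longrightarrow> Q x \<Longrightarrow> Q (x \<otimes>\<^bsub>H\<^esub> g)"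
      "x \<in> carrier H" for Q x
      using right[of Q x "\<one>\<^bsub>H\<^esub>"] that S(3) by simp
  qed
qed

section \<open>Non-archimedean absolute values and their extension to fractions\<close>

locale nonarch_norm =
  fixes \<nu> :: "'a::idom \<Rightarrow> real"
  assumes nonneg [simp]: "\<nu> x \<ge> 0"
    and eq_0_iff [simp]: "\<nu> x = 0 \<longleftrightarrow> x = 0"
    and mult: "\<nu> (x * y) = \<nu> x * \<nu> y"
    and add_le: "\<nu> (x + y) \<le> max (\<nu> x) (\<nu> y)"
begin

lemma zero [simp]: "\<nu> 0 = 0"
  by simp

lemma one [simp]: "\<nu> 1 = 1"
  using mult[of 1 1] by simp

lemma pos_iff [simp]: "\<nu> x > 0 \<longleftrightarrow> x \<noteq> 0"
  using nonneg[of x] eq_0_iff[of x] by linarith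

lemma minus [simp]: "\<nu> (- x) = \<nu> x"
proof -
  have "\<nu> (- x) ^ 2 = \<nu> x ^ 2"
    by (simp add: power2_eq_square flip: mult)
  then show ?thesis by simp
qed

lemma diff_le: "\<nu> (x - y) \<le> max (\<nu> x) (\<nu> y)"
  using add_le[of x "- y"] by simp

lemma power: "\<nu> (x ^ n) = \<nu> x ^ n"
  by (induction n) (simp_all add: mult)

end

lemma nonarch_norm_divide:
  fixes x y :: "'a::field"
  assumes "nonarch_norm (\<mu> :: 'a \<Rightarrow> real)"
  shows "\<mu> (x / y) = \<mu> x / \<mu> y"
proof (cases "y = 0")
  case False
  interpret m: nonarch_norm \<mu> by fact
  have "\<mu> (x / y) * \<mu> y = \<mu> x"
    using False by (simp flip: m.mult)
  with False show ?thesis by (simp add: field_simps)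
qed (use nonarch_norm.zero[OF assms] in simp)

lemma nonarch_norm_fract:
  fixes \<mu> :: "'a::idom \<Rightarrow> real"
  assumes "nonarch_norm \<mu>"
  obtains \<nu> :: "'a fract \<Rightarrow> real" where "nonarch_norm \<nu>" "\<And>x. \<nu> (to_fract x) = \<mu> x"
proof -
  interpret m: nonarch_norm \<mu> by fact
  define \<nu> where "\<nu> q = (THE r. \<exists>a b. b \<noteq> 0 \<and> q = Fract a b \<and> r = \<mu> a / \<mu> b)" for q
  have \<nu>: "\<nu> (Fract a b) = \<mu> a / \<mu> b" if "b \<noteq> 0" for a b
    unfolding \<nu>_def
  proof (rule the_equality)
    show "\<exists>a' b'. b' \<noteq> 0 \<and> Fract a b = Fract a' b' \<and> \<mu> a / \<mu> b = \<mu> a' / \<mu> b'"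
      using that by blast
    fix r assume "\<exists>a' b'. b' \<noteq> 0 \<and> Fract a b = Fract a' b' \<and> r = \<mu> a' / \<mu> b'"
    then obtain a' b' where *: "b' \<noteq> 0" "Fract a b = Fract a' b'" "r = \<mu> a' / \<mu> b'" by blast
    then have "a * b' = a' * b" using that by (simp add: eq_fract)
    then have "\<mu> a * \<mu> b' = \<mu> a' * \<mu> b" by (metis m.mult)
    moreover have "\<mu> b \<noteq> 0" "\<mu> b' \<noteq> 0" using * that by simp_all
    ultimately show "r = \<mu> a / \<mu> b" unfolding \<open>r = _\<close> by (simp add: frac_eq_eq)
  qed
  show thesis
  proof (rule that)
    show "nonarch_norm \<nu>"
    proof
      fix x y :: "'a fract"
      obtain a b where x: "x = Fract a b" "b \<noteq> 0" by (cases x)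
      obtain c d where y: "y = Fract c d" "d \<noteq> 0" by (cases y)
      show "\<nu> x \<ge> 0" using x by (simp add: \<nu>)
      show "\<nu> x = 0 \<longleftrightarrow> x = 0" using x by (simp add: \<nu> Zero_fract_def eq_fract)
      show "\<nu> (x * y) = \<nu> x * \<nu> y" using x y by (simp add: \<nu> m.mult)
      have "\<nu> (x + y) = \<mu> (a * d + c * b) / (\<mu> b * \<mu> d)" using x y by (simp add: \<nu> m.mult)
      also have "\<dots> \<le> max (\<mu> (a * d)) (\<mu> (c * b)) / (\<mu> b * \<mu> d)"
        by (intro divide_right_mono m.add_le mult_nonneg_nonneg m.nonneg)
      also have "\<dots> = max (\<nu> x) (\<nu> y)"
        using x y by (auto simp: \<nu> m.mult max_def field_simps)
      finally show "\<nu> (x + y) \<le> max (\<nu> x) (\<nu> y)" .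
    qed
    show "\<nu> (to_fract x) = \<mu> x" for x by (simp add: to_fract_def \<nu>)
  qed
qed

lemma vector_matrix_mult_2: "(v v* A) $ (j::'n::finite) = v $ 1 * A $ 1 $ j + v $ 2 * A $ 2 $ j"
  for v :: "'a::comm_semiring_1 ^ 2"
  by (simp add: vector_matrix_mult_def sum_2)

text \<open>Multiplicativity of the determinant for the matrix with rows \<open>w\<close> and
  \<open>z\<close>; it keeps the area spanned by \<open>w P\<close> and \<open>z P\<close> constant
  for \<open>P\<close> in \<open>SL2\<close>.\<close>

lemma det_rows_mult_2:
  fixes w z :: "'a::comm_ring_1 ^ 2"
  shows "(w v* g) $ 1 * (z v* g) $ 2 - (w v* g) $ 2 * (z v* g) $ 1
    = det g * (w $ 1 * z $ 2 - w $ 2 * z $ 1)"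
  by (simp add: vector_matrix_mult_2 det_2 algebra_simps)

text \<open>
  Let \<open>k\<close> be an index at which \<open>w P\<close> is maximal. Then \<open>(z P)\<^sub>k / (w P)\<^sub>k\<close> is the horospherical
  coordinate of \<open>P\<close>; as \<open>w P\<close> stays bounded away from \<open>0\<close>, right multiplication by a generator
  moves this coordinate by a bounded amount, and such moves do not add up under an ultrametric.
\<close>

lemma unipotent_translation_bounded:
  fixes \<nu> :: "'k::field \<Rightarrow> real" and w z :: "'k ^ 2" and \<Gamma> :: "('k ^ 2 ^ 2) set"
  assumes \<nu>: "nonarch_norm \<nu>"
    and \<Gamma>: "subgroup \<Gamma> SL2" "finitely_generated_group (SL2\<lparr>carrier := \<Gamma>\<rparr>)"
    and far: "\<And>P. P \<in> \<Gamma> \<Longrightarrow> \<exists>i. \<nu> ((w v* P) $ i) \<ge> 1"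
  obtains B where "\<And>P x. P \<in> \<Gamma> \<Longrightarrow> w v* P = w \<Longrightarrow> z v* P = z + x *s w \<Longrightarrow> \<nu> x \<le> B"
proof -
  interpret nonarch_norm \<nu> by fact
  let ?H = "SL2\<lparr>carrier := \<Gamma>\<rparr> :: ('k ^ 2 ^ 2) monoid"
  have "group ?H" by (rule subgroup.subgroup_is_group[OF \<Gamma>(1) group_SL2])
  then obtain G where G: "finite G" "G \<subseteq> carrier ?H"
    "\<And>Q x. Q \<one>\<^bsub>?H\<^esub> \<Longrightarrow> (\<And>x g. x \<in> carrier ?H \<Longrightarrow> g \<in> G \<Longrightarrow> Q x \<Longrightarrow> Q (x \<otimes>\<^bsub>?H\<^esub> g))
       \<Longrightarrow> x \<in> carrier ?H \<Longrightarrow> Q x"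
    using generated_group_word_induct[OF _ \<Gamma>(2)] by metis
  have det: "det P = 1" if "P \<in> \<Gamma>" for P
    using subgroup.subset[OF \<Gamma>(1)] that by (auto simp: SL2_def)
  define C where "C = Max (insert 0 ((\<lambda>(g, i, j). \<nu> (g $ i $ j)) ` (G \<times> UNIV)))"
  have C: "\<nu> (g $ i $ j) \<le> C" if "g \<in> G" for g i j
    unfolding C_def using G(1) that by (intro Max_ge) (auto simp: image_iff intro!: bexI[of _ g])
  have C0: "C \<ge> 0" unfolding C_def using G(1) by (intro Max_ge) auto
  define d where "d = w $ 1 * z $ 2 - w $ 2 * z $ 1"
  obtain m where m: "\<And>i. \<nu> (w $ i) \<le> \<nu> (w $ m)"
    by (metis (full_types) exhaust_2 linear)
  \<comment> \<open>The first term is the coordinate at the identity, the second bounds the change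
    made by one generator; by the ultrametric inequality their maximum survives every word.\<close>
  define B where "B = max (\<nu> (z $ m / w $ m)) (C * \<nu> d)"
  define Q where "Q P \<longleftrightarrow> (\<exists>k. (\<forall>i. \<nu> ((w v* P) $ i) \<le> \<nu> ((w v* P) $ k)) \<and>
    \<nu> ((z v* P) $ k / (w v* P) $ k) \<le> B)" for P :: "'k ^ 2 ^ 2"
  have big: "\<nu> ((w v* P) $ k) \<ge> 1" if "P \<in> \<Gamma>" "\<And>i. \<nu> ((w v* P) $ i) \<le> \<nu> ((w v* P) $ k)" for P k
    using far[OF that(1)] that(2) by (meson order_trans)
  have step: "Q (P ** g)" if P: "P \<in> \<Gamma>" and g: "g \<in> G" and "Q P" for P g
  proof -
    from g G(2) have g\<Gamma>: "g \<in> \<Gamma>" by auto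
    then have Pg: "P ** g \<in> \<Gamma>"
      using subgroup.m_closed[OF \<Gamma>(1) P g\<Gamma>] by (simp add: SL2_def)
    define w1 z1 where "w1 = w v* P" and "z1 = z v* P"
    obtain k where k: "\<And>i. \<nu> (w1 $ i) \<le> \<nu> (w1 $ k)" "\<nu> (z1 $ k / w1 $ k) \<le> B"
      using \<open>Q P\<close> by (auto simp: Q_def w1_def z1_def)
    have k1: "\<nu> (w1 $ k) \<ge> 1" using big[OF P] k(1) by (simp add: w1_def)
    then have k0: "w1 $ k \<noteq> 0" by auto
    define x where "x = z1 $ k / w1 $ k"
    have d1: "w1 $ 1 * z1 $ 2 - w1 $ 2 * z1 $ 1 = d"
      using det_rows_mult_2[of w P z] det[OF P] by (simp add: w1_def z1_def d_def)
    \<comment> \<open>Subtracting \<open>x *s w1\<close> kills entry \<open>k\<close> of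
      \<open>z1\<close>; constancy of the area makes the other entry \<open>d / w1 $ k\<close> up to
      sign, of norm at most \<open>\<nu> d\<close>.\<close>
    define y where "y = z1 - x *s w1"
    have y: "\<nu> (y $ i) \<le> \<nu> d" for i
    proof -
      have "y $ i * w1 $ k = z1 $ i * w1 $ k - z1 $ k * w1 $ i"
        using k0 by (simp add: y_def x_def field_simps)
      then have "y $ i = 0 \<or> y $ i * w1 $ k = d \<or> y $ i * w1 $ k = - d"
        using exhaust_2[of i] exhaust_2[of k] d1 k0
        by (auto simp: mult.commute)
      then have "\<nu> (y $ i) = 0 \<or> \<nu> (y $ i) * \<nu> (w1 $ k) = \<nu> d"
        by (metis minus mult zero)
      moreover have "\<nu> (y $ i) * 1 \<le> \<nu> (y $ i) * \<nu> (w1 $ k)"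
        using k1 by (intro mult_left_mono) auto
      ultimately show ?thesis by auto
    qed
    obtain l where l: "\<And>i. \<nu> ((w1 v* g) $ i) \<le> \<nu> ((w1 v* g) $ l)"
      by (metis (full_types) exhaust_2 linear)
    have l1: "\<nu> ((w1 v* g) $ l) \<ge> 1"
      using big[OF Pg] l by (simp add: w1_def vector_matrix_mul_assoc)
    then have l0: "(w1 v* g) $ l \<noteq> 0" by auto
    have "\<nu> ((y v* g) $ l) \<le> max (\<nu> (y $ 1 * g $ 1 $ l)) (\<nu> (y $ 2 * g $ 2 $ l))"
      by (simp add: vector_matrix_mult_2 add_le)
    also have "\<dots> \<le> C * \<nu> d"
    proof -
      have "\<nu> (y $ i * g $ i $ l) \<le> C * \<nu> d" for i
        unfolding mult mult.commute[of "\<nu> (y $ i)"] using C[OF g] y C0 by (intro mult_mono) auto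
      then show ?thesis by simp
    qed
    finally have yl: "\<nu> ((y v* g) $ l) \<le> C * \<nu> d" .
    \<comment> \<open>The new coordinate is the old one plus the contribution of \<open>y\<close>,
      even if the dominant index changes from \<open>k\<close> to \<open>l\<close>.\<close>
    have "(z1 v* g) $ l / (w1 v* g) $ l = x + (y v* g) $ l / (w1 v* g) $ l"
      using l0 by (simp add: y_def vector_matrix_mult_2 field_simps)
    then have "\<nu> ((z1 v* g) $ l / (w1 v* g) $ l) \<le> max (\<nu> x) (\<nu> ((y v* g) $ l / (w1 v* g) $ l))"
      using add_le by metis
    moreover have "\<nu> ((y v* g) $ l / (w1 v* g) $ l) \<le> C * \<nu> d"
    proof -
      have "\<nu> ((y v* g) $ l / (w1 v* g) $ l) = \<nu> ((y v* g) $ l) / \<nu> ((w1 v* g) $ l)"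
        by (rule nonarch_norm_divide[OF \<nu>])
      also have "\<dots> \<le> \<nu> ((y v* g) $ l) / 1"
        using l1 by (intro divide_left_mono) auto
      finally show ?thesis using yl by simp
    qed
    ultimately have "\<nu> ((z1 v* g) $ l / (w1 v* g) $ l) \<le> B"
      using k(2) by (auto simp: x_def B_def)
    with l show ?thesis unfolding Q_def
      by (auto simp: w1_def z1_def vector_matrix_mul_assoc intro!: exI[of _ l])
  qed
  have "Q (mat 1)" unfolding Q_def using m by (auto simp: B_def intro!: exI[of _ m])
  then have Q: "Q P" if "P \<in> \<Gamma>" for P
    using G(3)[of Q P] step that by (auto simp: SL2_def)
  show thesis
  proof (rule that)
    fix P x assume P: "P \<in> \<Gamma>" "w v* P = w" "z v* P = z + x *s w"
    obtain k where k: "\<And>i. \<nu> (w $ i) \<le> \<nu> (w $ k)" "\<nu> ((z + x *s w) $ k / w $ k) \<le> B"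
      using Q[OF P(1)] P by (auto simp: Q_def)
    have "\<nu> (w $ k) \<ge> 1" using big[OF P(1), of k] k(1) unfolding P(2) by blast
    then have "w $ k \<noteq> 0" by auto
    \<comment> \<open>The coordinate of such a \<open>P\<close> at \<open>k\<close> is
      \<open>z $ k / w $ k + x\<close>. The dominant index \<open>k\<close> is not known in advance,
      so the final bound covers both indices.\<close>
    then have "x = (z + x *s w) $ k / w $ k - z $ k / w $ k"
      by (simp add: field_simps)
    then have "\<nu> x \<le> max (\<nu> ((z + x *s w) $ k / w $ k)) (\<nu> (z $ k / w $ k))"
      using diff_le by metis
    also have "\<dots> \<le> max B (max (\<nu> (z $ 1 / w $ 1)) (\<nu> (z $ 2 / w $ 2)))"
      using k(2) exhaust_2[of k] by auto
    finally show "\<nu> x \<le> max B (max (\<nu> (z $ 1 / w $ 1)) (\<nu> (z $ 2 / w $ 2)))" .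
  qed
qed

section \<open>Weighted degrees\<close>

locale comm_ring_hom_map =
  fixes f :: "'a::comm_ring_1 \<Rightarrow> 'b::comm_ring_1"
  assumes add [simp]: "f (x + y) = f x + f y"
    and mult [simp]: "f (x * y) = f x * f y"
    and one [simp]: "f 1 = 1"
begin

lemma zero [simp]: "f 0 = 0"
  using add[of 0 0] by simp

lemma minus [simp]: "f (- x) = - f x"
  using add[of x "- x"] by (simp add: add_eq_0_iff)

lemma diff [simp]: "f (x - y) = f x - f y"
  using add[of x "- y"] by simp

lemma sum: "f (sum g A) = (\<Sum>x\<in>A. f (g x))"
  by (induction A rule: infinite_finite_induct) auto

lemma power [simp]: "f (x ^ n) = f x ^ n"
  by (induction n) auto

lemma map_poly: "comm_ring_hom_map (map_poly f)"
proof
  show "map_poly f (p + q) = map_poly f p + map_poly f q" for p q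
    by (intro poly_eqI) (simp add: coeff_map_poly)
  show "map_poly f (p * q) = map_poly f p * map_poly f q" for p q
    by (intro poly_eqI) (simp add: coeff_map_poly coeff_mult sum)
qed simp

end

lemma comm_ring_hom_map_comp:
  assumes "comm_ring_hom_map f" "comm_ring_hom_map g"
  shows "comm_ring_hom_map (\<lambda>x. g (f x))"
proof -
  interpret f: comm_ring_hom_map f by fact
  interpret g: comm_ring_hom_map g by fact
  show ?thesis by standard auto
qed

lemma comm_ring_hom_map_const: "comm_ring_hom_map (\<lambda>a :: 'a::comm_ring_1. [:a:])"
  by standard (auto simp: one_pCons)

lemma comm_ring_hom_map_poly: "comm_ring_hom_map (\<lambda>p. poly p (x :: 'a::comm_ring_1))"
  by standard auto

lemma comm_ring_hom_map_coeff_0: "comm_ring_hom_map (\<lambda>p :: 'a::comm_ring_1 poly. coeff p 0)"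
  by standard (auto simp: coeff_mult)

text \<open>
  Here \<open>'a poly poly\<close> is \<open>R\<^sub>0[s][t]\<close> on the source side and \<open>R\<^sub>0[Y][X]\<close> on the target side, and
  \<open>weight_hom N\<close> maps \<open>s\<close> to \<open>X\<close> and \<open>t\<close> to \<open>X ^ N * (1 + Y)\<close>. The weighted degree becomes the degree in
  \<open>X\<close>, and \<open>t - s ^ N\<close> becomes \<open>X ^ N * Y\<close>.
\<close>

definition weight_hom :: "nat \<Rightarrow> 'a::comm_ring_1 poly poly \<Rightarrow> 'a poly poly" where
  "weight_hom N q = poly (map_poly (map_poly (\<lambda>a. [:a:])) q) (monom [:1, 1:] N)"

lemma comm_ring_hom_map_weight_hom: "comm_ring_hom_map (weight_hom N)"
  unfolding weight_hom_def
  by (intro comm_ring_hom_map_comp[OF _ comm_ring_hom_map_poly] comm_ring_hom_map.map_poly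
      comm_ring_hom_map_const)

text \<open>A monomial \<open>s ^ i * t ^ j\<close> goes to
  \<open>X ^ (i + N * j) * (1 + Y) ^ j\<close>. The case distinction guards the truncated
  subtraction \<open>k - N * j\<close>.\<close>

lemma coeff_weight_hom:
  "coeff (weight_hom N q) k =
    (\<Sum>j\<le>degree q. if k < N * j then 0 else smult (coeff (coeff q j) (k - N * j)) ([:1, 1:] ^ j))"
proof -
  have "degree (map_poly (map_poly (\<lambda>a :: 'a. [:a:])) q) = degree q"
    by (rule degree_map_poly) (auto simp: map_poly_eq_0_iff)
  then have "weight_hom N q = (\<Sum>j\<le>degree q. map_poly (\<lambda>a. [:a:]) (coeff q j) * monom ([:1, 1:] ^ j) (N * j))"
    by (simp add: weight_hom_def poly_altdef coeff_map_poly monom_power)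
  also have "\<dots> = (\<Sum>j\<le>degree q. monom ([:1, 1:] ^ j) (N * j) * map_poly (\<lambda>a. [:a:]) (coeff q j))"
    by (simp only: mult.commute)
  finally have "coeff (weight_hom N q) k = (\<Sum>j\<le>degree q. if k < N * j then 0
      else [:1, 1:] ^ j * [:coeff (coeff q j) (k - N * j):])"
    by (simp add: coeff_sum coeff_monom_mult coeff_map_poly cong: if_cong)
  then show ?thesis by (simp cong: if_cong)
qed

text \<open>Among the \<open>j \<le> d\<close> only \<open>j = d\<close> contributes to
  \<open>Y ^ d\<close>, because \<open>(1 + Y) ^ j\<close> has degree \<open>j\<close>. This
  isolates the leading coefficient of \<open>q\<close> for every \<open>N\<close>.\<close>

lemma weight_hom_eq_0_iff [simp]:
  fixes q :: "'a::idom poly poly"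
  shows "weight_hom N q = 0 \<longleftrightarrow> q = 0"
proof
  assume 0: "weight_hom N q = 0"
  define d e where "d = degree q" and "e = degree (lead_coeff q)"
  have "0 = coeff (coeff (weight_hom N q) (e + N * d)) d" using 0 by simp
  also have "\<dots> = (\<Sum>j\<le>d. coeff (if e + N * d < N * j then 0
      else smult (coeff (coeff q j) (e + N * d - N * j)) ([:1, 1:] ^ j)) d)"
    unfolding coeff_weight_hom coeff_sum d_def ..
  also have "\<dots> = (\<Sum>j\<in>{d}. coeff (if e + N * d < N * j then 0
      else smult (coeff (coeff q j) (e + N * d - N * j)) ([:1, 1:] ^ j)) d)"
    by (intro sum.mono_neutral_right) (auto simp: coeff_eq_0 degree_power_eq)
  also have "\<dots> = lead_coeff (lead_coeff q) * coeff ([:1, 1:] ^ d) d"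
    by (simp add: d_def e_def)
  also have "coeff ([:1, 1 :: 'a:] ^ d) d = 1"
    using lead_coeff_power[of "[:1, 1 :: 'a:]" d] by (simp add: degree_power_eq)
  finally show "q = 0" by simp
qed (simp add: weight_hom_def)

text \<open>The monomial with the highest power of \<open>t\<close> and then of \<open>s\<close>
  outweighs all others. The top coefficient in \<open>X\<close> is therefore a constant times
  \<open>(1 + Y) ^ d\<close>, and \<open>Y = 0\<close> recovers the constant.\<close>

lemma lead_coeff_weight_hom:
  fixes q :: "'a::idom poly poly"
  assumes "q \<noteq> 0" and N: "\<And>j. degree (coeff q j) < N"
  shows "coeff (lead_coeff (weight_hom N q)) 0 = lead_coeff (lead_coeff q)"
proof -
  define d e where "d = degree q" and "e = degree (lead_coeff q)"
  have top: "coeff (weight_hom N q) k = (if k < N * d then 0 else smult (coeff (coeff q d) (k - N * d)) ([:1, 1:] ^ d))"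
    if k: "k \<ge> e + N * d" for k
  proof -
    have "coeff (weight_hom N q) k = (\<Sum>j\<in>{d}. if k < N * j then 0
        else smult (coeff (coeff q j) (k - N * j)) ([:1, 1:] ^ j))"
      unfolding coeff_weight_hom d_def[symmetric]
    proof (intro sum.mono_neutral_right ballI)
      fix j assume "j \<in> {..d} - {d}"
      \<comment> \<open>Lowering the power of \<open>t\<close> costs weight at least
        \<open>N\<close>, more than any power of \<open>s\<close> in \<open>coeff q j\<close> makes
        up for.\<close>
      then have "N * Suc j \<le> N * d" by (intro mult_le_mono) auto
      then have "N \<le> k - N * j" using k by simp
      then have "coeff (coeff q j) (k - N * j) = 0" using N[of j] by (intro coeff_eq_0) simp
      then show "(if k < N * j then 0 else smult (coeff (coeff q j) (k - N * j)) ([:1, 1:] ^ j)) = 0" by simp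
    qed auto
    then show ?thesis by simp
  qed
  have lc: "coeff (weight_hom N q) (e + N * d) = smult (lead_coeff (lead_coeff q)) ([:1, 1:] ^ d)"
    by (subst top) (auto simp: d_def e_def)
  have "degree (weight_hom N q) = e + N * d"
  proof (rule antisym)
    show "degree (weight_hom N q) \<le> e + N * d"
      by (intro degree_le allI impI) (auto simp: top d_def e_def coeff_eq_0)
    show "e + N * d \<le> degree (weight_hom N q)"
      using lc assms(1) by (intro le_degree) auto
  qed
  then show ?thesis by (simp add: lc coeff_0_power)
qed

lemma weight_hom_const [simp]: "weight_hom N [:[:p:]:] = [:[:p:]:]"
  by (simp add: weight_hom_def map_poly_pCons)

lemma weight_hom_monom [simp]: "weight_hom N [:monom 1 n:] = monom 1 n"
  by (simp add: weight_hom_def map_poly_pCons map_poly_monom one_pCons)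

lemma weight_hom_diff_monom [simp]:
  "weight_hom N [:- monom 1 N, 1:] = monom [:0, 1 :: 'a::comm_ring_1:] N"
proof -
  interpret comm_ring_hom_map "map_poly (\<lambda>a :: 'a. [:a:])"
    by (intro comm_ring_hom_map.map_poly comm_ring_hom_map_const)
  have "weight_hom N [:- monom (1 :: 'a) N, 1:] = monom [:1, 1:] N - monom 1 N"
    by (simp add: weight_hom_def map_poly_pCons map_poly_monom flip: one_pCons)
  also have "\<dots> = monom [:0, 1:] N"
    by (simp add: diff_monom one_pCons)
  finally show ?thesis .
qed

text \<open>Write \<open>A0\<close>, \<open>A1\<close> for the coefficients of \<open>Y ^ 0\<close>
  and \<open>Y ^ 1\<close>. Since \<open>a0 = p * A0\<close> and
  \<open>a1 = p * A1 + X ^ N * C0\<close>, and likewise for \<open>b\<close>, the combination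
  \<open>A0 * b1 - B0 * a1\<close> is congruent to \<open>X ^ N * f0 ^ M\<close> modulo
  \<open>p\<close>. Its coefficient at \<open>N + M * degree f\<close> thus survives, which bounds
  \<open>degree a + degree b\<close> from below.\<close>

lemma prime_pencil_degree:
  fixes A B C D f :: "'a::idom poly poly" and p :: 'a
  assumes det: "A * D - B * C = f ^ M"
    and p: "prime_elem p" "\<not> p dvd coeff (lead_coeff f) 0"
    and a: "a = [:[:p:]:] * A + monom [:0, 1:] N * C"
    and b: "b = [:[:p:]:] * B + monom [:0, 1:] N * D"
  shows "a \<noteq> 0" "b \<noteq> 0" "N + M * degree f \<le> degree a + degree b"
proof -
  \<comment> \<open>the coefficients of \<open>Y ^ 0\<close> and \<open>Y ^ 1\<close>\<close>
  define c0 c1 :: "'a poly poly \<Rightarrow> 'a poly"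
    where "c0 = map_poly (\<lambda>q. coeff q 0)" and "c1 = map_poly (\<lambda>q. coeff q 1)"
  interpret c0: comm_ring_hom_map c0
    unfolding c0_def by (intro comm_ring_hom_map.map_poly comm_ring_hom_map_coeff_0)
  have c0: "c0 ([:[:p:]:] * x + monom [:0, 1:] N * y) = smult p (c0 x)" for x y
    by (intro poly_eqI) (simp add: c0_def coeff_map_poly coeff_monom_mult)
  have c1: "c1 ([:[:p:]:] * x + monom [:0, 1:] N * y) = smult p (c1 x) + monom 1 N * c0 y" for x y
    by (intro poly_eqI) (simp add: c0_def c1_def coeff_map_poly coeff_monom_mult coeff_pCons)
  have p0: "p \<noteq> 0" using p by auto
  have deg: "degree (c0 x) \<le> degree x" "degree (c1 x) \<le> degree x" for x
    by (simp_all add: c0_def c1_def map_poly_degree_leq)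
  have "c0 A * c0 D - c0 B * c0 C = c0 f ^ M"
    using arg_cong[OF det, of c0] by simp
  then have id: "c0 A * c1 b - c0 B * c1 a = monom 1 N * c0 f ^ M + smult p (c0 A * c1 B - c0 B * c1 A)"
    unfolding a b c1 by (simp add: algebra_simps smult_diff_right flip: \<open>_ = c0 f ^ M\<close>)
  define K where "K = N + M * degree f"
  have f0: "coeff (c0 f) (degree f) = coeff (lead_coeff f) 0"
    by (simp add: c0_def coeff_map_poly)
  \<comment> \<open>Setting \<open>Y = 0\<close> keeps the degree: the coefficient in question is
    not divisible by \<open>p\<close>, hence nonzero.\<close>
  then have df: "degree (c0 f) = degree f"
    using p(2) deg(1)[of f] by (metis antisym dvd_0_right le_degree)
  have "coeff (monom 1 N * c0 f ^ M) K = coeff (lead_coeff f) 0 ^ M"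
  proof -
    have "c0 f \<noteq> 0" using f0 p(2) by auto
    then have "degree (c0 f ^ M) = M * degree f" using df by (simp add: degree_power_eq)
    moreover have "lead_coeff (c0 f ^ M) = coeff (lead_coeff f) 0 ^ M"
      unfolding lead_coeff_power by (simp add: df f0)
    ultimately show ?thesis by (simp add: K_def coeff_monom_mult)
  qed
  moreover have "\<not> p dvd coeff (lead_coeff f) 0 ^ M"
    using p prime_elem_dvd_power by blast
  ultimately have "\<not> p dvd coeff (c0 A * c1 b - c0 B * c1 a) K"
    unfolding id by (simp add: dvd_add_left_iff)
  then have nz: "coeff (c0 A * c1 b - c0 B * c1 a) K \<noteq> 0" by auto
  have ca: "c0 a = smult p (c0 A)" and cb: "c0 b = smult p (c0 B)"
    unfolding a b by (rule c0)+
  have [simp]: "c1 0 = 0" by (simp add: c1_def)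
  show "a \<noteq> 0" using nz ca p0 by auto
  show "b \<noteq> 0" using nz cb p0 by auto
  show "N + M * degree f \<le> degree a + degree b"
  proof (rule ccontr)
    assume less: "\<not> ?thesis"
    have "degree (c0 A) \<le> degree a" using deg(1)[of a] ca p0 by simp
    then have "degree (c0 A * c1 b) \<le> degree a + degree b"
      using degree_mult_le[of "c0 A" "c1 b"] deg(2)[of b] by linarith
    moreover have "degree (c0 B) \<le> degree b" using deg(1)[of b] cb p0 by simp
    then have "degree (c0 B * c1 a) \<le> degree a + degree b"
      using degree_mult_le[of "c0 B" "c1 a"] deg(2)[of a] by linarith
    ultimately have "coeff (c0 A * c1 b - c0 B * c1 a) K = 0"
      using less by (simp add: K_def coeff_eq_0)
    with nz show False by simp
  qed
qed

lemma nonarch_norm_degree: "nonarch_norm (\<lambda>q :: 'a::idom poly. if q = 0 then 0 else 2 ^ degree q)"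
proof
  fix p q :: "'a poly"
  show "(if p + q = 0 then 0 else 2 ^ degree (p + q))
    \<le> max (if p = 0 then 0 else 2 ^ degree p) (if q = 0 then 0 else 2 ^ degree q :: real)"
    using degree_add_le_max[of p q] by (auto simp: max_def split: if_splits)
qed (auto simp: degree_mult_eq power_add)

lemma nonarch_norm_comp:
  assumes "nonarch_norm \<mu>" "comm_ring_hom_map f" "\<And>x :: 'a::idom. f x = 0 \<Longrightarrow> x = 0"
  shows "nonarch_norm (\<lambda>x. \<mu> (f x))"
proof -
  interpret \<mu>: nonarch_norm \<mu> by fact
  interpret f: comm_ring_hom_map f by fact
  show ?thesis by standard (use assms(3) \<mu>.add_le in \<open>auto simp: \<mu>.mult\<close>)
qed

section \<open>Localizations\<close>

definition localization :: "'a::idom \<Rightarrow> 'a fract set" where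
  "localization f = {x. \<exists>a m. x * to_fract f ^ m = to_fract a}"

lemma to_fract_power: "to_fract (a ^ n) = to_fract a ^ n"
  by (induction n) auto

lemma localization_closed:
  shows to_fract_localization: "to_fract a \<in> localization f"
    and "x \<in> localization f \<Longrightarrow> y \<in> localization f \<Longrightarrow> x + y \<in> localization f"
    and "x \<in> localization f \<Longrightarrow> y \<in> localization f \<Longrightarrow> x * y \<in> localization f"
proof -
  show "to_fract a \<in> localization f"
    unfolding localization_def by (intro CollectI exI[of _ a] exI[of _ 0]) simp
  assume "x \<in> localization f" "y \<in> localization f"
  then obtain a b m n where *: "x * to_fract f ^ m = to_fract a" "y * to_fract f ^ n = to_fract b"
    by (auto simp: localization_def)
  have "(x + y) * to_fract f ^ (m + n) = (x * to_fract f ^ m) * to_fract f ^ n + (y * to_fract f ^ n) * to_fract f ^ m"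
    by (simp add: algebra_simps power_add)
  also have "\<dots> = to_fract (a * f ^ n + b * f ^ m)" unfolding * by (simp add: to_fract_power)
  finally show "x + y \<in> localization f" unfolding localization_def by blast
  have "(x * y) * to_fract f ^ (m + n) = (x * to_fract f ^ m) * (y * to_fract f ^ n)"
    by (simp add: algebra_simps power_add)
  also have "\<dots> = to_fract (a * b)" unfolding * by simp
  finally show "x * y \<in> localization f" unfolding localization_def by blast
qed

text \<open>The product of the denominators of the elements of \<open>E\<close> works, already with
  exponent 1.\<close>

lemma finite_subset_localization:
  assumes "finite (E :: 'a::idom fract set)"
  obtains f where "f \<noteq> 0" "E \<subseteq> localization f"
proof -
  have "\<exists>f. f \<noteq> 0 \<and> (\<forall>x\<in>E. \<exists>a. x * to_fract f = to_fract a)" using assms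
  proof (induction E)
    case (insert x E)
    then obtain f where f: "f \<noteq> 0" "\<forall>y\<in>E. \<exists>a. y * to_fract f = to_fract a" by blast
    obtain b c where x: "x = Fract b c" "c \<noteq> 0" by (cases x)
    have "x * to_fract c = to_fract b" using x by (simp add: to_fract_def eq_fract)
    then have xcf: "x * to_fract (c * f) = to_fract (b * f)"
      unfolding to_fract_mult by (simp only: mult.assoc[symmetric])
    have "\<exists>a. y * to_fract (c * f) = to_fract a" if y: "y \<in> insert x E" for y
    proof (cases "y = x")
      case True
      then show ?thesis using xcf by blast
    next
      case False
      then obtain a where a: "y * to_fract f = to_fract a" using f(2) y by blast
      have "y * to_fract (c * f) = to_fract c * (y * to_fract f)"
        unfolding to_fract_mult by (simp only: mult_ac)
      also have "\<dots> = to_fract (c * a)" unfolding a to_fract_mult ..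
      finally show ?thesis by blast
    qed
    then have "c * f \<noteq> 0 \<and> (\<forall>y\<in>insert x E. \<exists>a. y * to_fract (c * f) = to_fract a)"
      using f(1) x(2) by simp
    then show ?case by (rule exI)
  next
    case empty
    show ?case by (intro exI[of _ 1]) simp
  qed
  then obtain f where f: "f \<noteq> 0" "\<forall>x\<in>E. \<exists>a. x * to_fract f = to_fract a" by blast
  show thesis
  proof (rule that[OF f(1)], rule subsetI)
    fix x assume "x \<in> E"
    then obtain a where "x * to_fract f ^ 1 = to_fract a" using f(2) by auto
    then show "x \<in> localization f" unfolding localization_def by blast
  qed
qed

text \<open>A common denominator for the entries of the finitely many letters serves all words,
  since a localization is closed under sums and products.\<close>

lemma finitely_generated_subgroup_localization:
  fixes \<Gamma> :: "('a::idom fract ^ 2 ^ 2) set"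
  assumes "subgroup \<Gamma> SL2" "finitely_generated_group (SL2\<lparr>carrier := \<Gamma>\<rparr>)"
  obtains f where "f \<noteq> 0" "\<And>P i j. P \<in> \<Gamma> \<Longrightarrow> P $ i $ j \<in> localization f"
proof -
  let ?H = "SL2\<lparr>carrier := \<Gamma>\<rparr> :: ('a fract ^ 2 ^ 2) monoid"
  have "group ?H" by (rule subgroup.subgroup_is_group[OF assms(1) group_SL2])
  then obtain G where G: "finite G" "G \<subseteq> carrier ?H"
    "\<And>Q x. Q \<one>\<^bsub>?H\<^esub> \<Longrightarrow> (\<And>x g. x \<in> carrier ?H \<Longrightarrow> g \<in> G \<Longrightarrow> Q x \<Longrightarrow> Q (x \<otimes>\<^bsub>?H\<^esub> g))
       \<Longrightarrow> x \<in> carrier ?H \<Longrightarrow> Q x"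
    using generated_group_word_induct[OF _ assms(2)] by metis
  have "finite ((\<lambda>(g, i, j). g $ i $ j) ` (G \<times> UNIV))" using G(1) by simp
  then obtain f where f: "f \<noteq> 0" "(\<lambda>(g, i, j). g $ i $ j) ` (G \<times> UNIV) \<subseteq> localization f"
    by (rule finite_subset_localization)
  have g: "g $ i $ j \<in> localization f" if "g \<in> G" for g i j
  proof -
    have "g $ i $ j \<in> (\<lambda>(g, i, j). g $ i $ j) ` (G \<times> UNIV)"
      by (rule image_eqI[of _ _ "(g, i, j)"]) (use that in auto)
    then show ?thesis by (rule subsetD[OF f(2)])
  qed
  have "\<forall>i j. P $ i $ j \<in> localization f" if P: "P \<in> \<Gamma>" for P
  proof (rule G(3)[of "\<lambda>P. \<forall>i j. P $ i $ j \<in> localization f" P])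
    show "\<forall>i j. \<one>\<^bsub>?H\<^esub> $ i $ j \<in> localization f"
      using to_fract_localization[of 0 f] to_fract_localization[of 1 f] by (simp add: SL2_def mat_def)
    show "\<forall>i j. (P \<otimes>\<^bsub>?H\<^esub> h) $ i $ j \<in> localization f"
      if h: "h \<in> G" and P: "\<forall>i j. P $ i $ j \<in> localization f" for P h
      using P g[OF h] by (simp add: SL2_def matrix_matrix_mult_def sum_2 localization_closed)
  qed (use P in simp)
  then show thesis by (intro that[OF f(1)]) blast
qed

text \<open>The form with \<open>eventually\<close> lets finitely many entries share one
  exponent.\<close>

lemma localization_eventually:
  assumes "x \<in> localization f"
  shows "eventually (\<lambda>n. \<exists>a. x * to_fract f ^ n = to_fract a) sequentially"
proof -
  obtain a m where a: "x * to_fract f ^ m = to_fract a"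
    using assms by (auto simp: localization_def)
  show ?thesis
    unfolding eventually_sequentially
  proof (intro exI[of _ m] allI impI)
    fix n assume "m \<le> n"
    then have "x * to_fract f ^ n = (x * to_fract f ^ m) * to_fract f ^ (n - m)"
      by (simp add: mult.assoc flip: power_add)
    also have "\<dots> = to_fract (a * f ^ (n - m))" unfolding a by (simp add: to_fract_power)
    finally show "\<exists>a. x * to_fract f ^ n = to_fract a" by blast
  qed
qed

lemma localization_common_denominator:
  fixes P :: "'a::idom fract ^ 'n::finite ^ 'm::finite"
  assumes "\<And>i j. P $ i $ j \<in> localization f"
  obtains A k where "\<And>i j. P $ i $ j * to_fract f ^ k = to_fract (A i j)"
proof -
  have "eventually (\<lambda>n. \<forall>i j. \<exists>a. P $ i $ j * to_fract f ^ n = to_fract a) sequentially"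
    by (intro eventually_all_finite localization_eventually assms)
  then obtain k where "\<forall>i j. \<exists>a. P $ i $ j * to_fract f ^ k = to_fract a"
    unfolding eventually_sequentially by blast
  then show thesis using that by metis
qed

section \<open>Primes of finitely generated domains\<close>

text \<open>Subrings are sets inside one type, so that generators can be adjoined one after the
  other without changing the type.\<close>

definition subring_set :: "'a::comm_ring_1 set \<Rightarrow> bool" where
  "subring_set A \<longleftrightarrow> 1 \<in> A \<and> (\<forall>x\<in>A. \<forall>y\<in>A. x - y \<in> A \<and> x * y \<in> A)"

definition ideal_set :: "'a::comm_ring_1 set \<Rightarrow> 'a set \<Rightarrow> bool" where
  "ideal_set A J \<longleftrightarrow> J \<subseteq> A \<and> 0 \<in> J \<and> (\<forall>x\<in>J. \<forall>y\<in>J. x - y \<in> J) \<and> (\<forall>a\<in>A. \<forall>x\<in>J. a * x \<in> J)"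

text \<open>The last clause says that \<open>G\<close> generates \<open>J\<close> as an ideal of \<open>A\<close>.\<close>

definition noetherian_set :: "'a::comm_ring_1 set \<Rightarrow> bool" where
  "noetherian_set A \<longleftrightarrow> subring_set A \<and>
     (\<forall>J. ideal_set A J \<longrightarrow> (\<exists>G. finite G \<and> G \<subseteq> J \<and> (\<forall>K. ideal_set A K \<longrightarrow> G \<subseteq> K \<longrightarrow> J \<subseteq> K)))"

lemma subring_set_closed:
  assumes "subring_set A"
  shows "0 \<in> A" "1 \<in> A" "x \<in> A \<Longrightarrow> - x \<in> A"
    "x \<in> A \<Longrightarrow> y \<in> A \<Longrightarrow> x - y \<in> A" "x \<in> A \<Longrightarrow> y \<in> A \<Longrightarrow> x + y \<in> A"
    "x \<in> A \<Longrightarrow> y \<in> A \<Longrightarrow> x * y \<in> A"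
proof -
  have d: "x - y \<in> A" if "x \<in> A" "y \<in> A" for x y using assms that by (auto simp: subring_set_def)
  show 1: "1 \<in> A" using assms by (auto simp: subring_set_def)
  show 0: "0 \<in> A" using d[OF 1 1] by simp
  show m: "- x \<in> A" if "x \<in> A" for x using d[OF 0 that] by simp
  show "x - y \<in> A" if "x \<in> A" "y \<in> A" using d that .
  show "x + y \<in> A" if "x \<in> A" "y \<in> A" using d[OF that(1) m[OF that(2)]] by simp
  show "x * y \<in> A" if "x \<in> A" "y \<in> A" using assms that by (auto simp: subring_set_def)
qed

lemma ideal_set_closed:
  assumes "ideal_set A J"
  shows "J \<subseteq> A" "0 \<in> J" "x \<in> J \<Longrightarrow> y \<in> J \<Longrightarrow> x - y \<in> J" "x \<in> J \<Longrightarrow> y \<in> J \<Longrightarrow> x + y \<in> J"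
    "a \<in> A \<Longrightarrow> x \<in> J \<Longrightarrow> a * x \<in> J"
proof -
  have 0: "0 \<in> J" using assms by (auto simp: ideal_set_def)
  have d: "x - y \<in> J" if "x \<in> J" "y \<in> J" for x y
    using assms that by (auto simp: ideal_set_def)
  show "J \<subseteq> A" "0 \<in> J" using assms by (auto simp: ideal_set_def)
  show "x - y \<in> J" if "x \<in> J" "y \<in> J" using d that .
  show "x + y \<in> J" if "x \<in> J" "y \<in> J" using d[OF that(1) d[OF 0 that(2)]] by simp
  show "a * x \<in> J" if "a \<in> A" "x \<in> J" using assms that by (auto simp: ideal_set_def)
qed

text \<open>Division with remainder by the least positive integer whose image lies in
  \<open>J\<close>. Working with integers rather than their images covers positive characteristic;
  if no such integer exists, \<open>J\<close> is zero.\<close>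

lemma noetherian_set_range_of_int: "noetherian_set (range of_int :: 'a::comm_ring_1 set)"
  unfolding noetherian_set_def
proof (intro conjI allI impI)
  show "subring_set (range of_int :: 'a set)"
    by (auto simp: subring_set_def image_iff) (metis of_int_1, metis of_int_diff, metis of_int_mult)
  fix J :: "'a set" assume J: "ideal_set (range of_int) J"
  show "\<exists>G. finite G \<and> G \<subseteq> J \<and> (\<forall>K. ideal_set (range of_int) K \<longrightarrow> G \<subseteq> K \<longrightarrow> J \<subseteq> K)"
  proof (cases "\<exists>n>0. of_int (int n) \<in> J")
    case True
    define n where "n = (LEAST n. n > 0 \<and> (of_int (int n) :: 'a) \<in> J)"
    have n: "n > 0" "of_int (int n) \<in> J" using LeastI_ex[OF True] by (auto simp: n_def)
    have least: "\<not> (of_int (int k) \<in> J \<and> 0 < k)" if "k < n" for k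
      using not_less_Least that unfolding n_def by blast
    have dvd: "int n dvd m" if m: "of_int m \<in> J" for m
    proof -
      have "of_int (m div int n) * of_int (int n) \<in> J"
        by (rule ideal_set_closed(5)[OF J _ n(2)]) simp
      then have "of_int m - of_int (m div int n) * of_int (int n) \<in> J"
        by (rule ideal_set_closed(3)[OF J m])
      moreover have "m - m div int n * int n = int (nat (m mod int n))"
        using n(1) by (simp add: minus_div_mult_eq_mod)
      ultimately have "of_int (int (nat (m mod int n))) \<in> J"
        by (metis of_int_diff of_int_mult)
      with least[of "nat (m mod int n)"] n(1) have "\<not> 0 < nat (m mod int n)"
        by (auto simp: nat_less_iff)
      with n(1) have "m mod int n = 0"
        by (smt (verit) pos_mod_sign of_nat_0_less_iff zero_less_nat_eq)
      then show ?thesis by auto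
    qed
    show ?thesis
    proof (intro exI[of _ "{of_int (int n)}"] conjI allI impI subsetI)
      fix K :: "'a set" and x assume K: "ideal_set (range of_int) K" "{of_int (int n)} \<subseteq> K" and x: "x \<in> J"
      obtain m where m: "x = of_int m" using ideal_set_closed(1)[OF J] x by auto
      then obtain q where "m = int n * q" using dvd x by (auto elim: dvdE)
      then have "x = of_int q * of_int (int n)" using m by (metis mult.commute of_int_mult)
      then show "x \<in> K" using ideal_set_closed(5)[OF K(1), of "of_int q" "of_int (int n)"] K(2) by auto
    qed (use n in auto)
  next
    case False
    have "x = 0" if x: "x \<in> J" for x
    proof -
      obtain m where m: "x = of_int m" using ideal_set_closed(1)[OF J] x by auto
      have "of_int (- m) \<in> J" using ideal_set_closed(3)[OF J ideal_set_closed(2)[OF J] x] m by simp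
      then have "\<not> m > 0" "\<not> m < 0"
        using False x m by (metis zero_less_imp_eq_int, metis neg_0_less_iff_less zero_less_imp_eq_int)
      then show ?thesis using m by simp
    qed
    then show ?thesis by (intro exI[of _ "{}"]) (auto dest: ideal_set_closed(2))
  qed
qed

section \<open>Hilbert's basis theorem for the adjunction of one element\<close>

definition adjoin :: "'a::comm_ring_1 set \<Rightarrow> 'a \<Rightarrow> 'a set" where
  "adjoin A x = {poly q x |q. \<forall>i. coeff q i \<in> A}"

lemma subring_set_adjoin:
  assumes A: "subring_set A"
  shows "subring_set (adjoin A x)" "A \<subseteq> adjoin A x" "x \<in> adjoin A x"
proof -
  note c = subring_set_closed[OF A]
  have sum: "sum f {..n} \<in> A" if "\<And>i. f i \<in> A" for f and n :: nat
    using that c by (induction n) auto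
  have const: "a \<in> adjoin A x" if "a \<in> A" for a
    unfolding adjoin_def using that c by (intro CollectI exI[of _ "[:a:]"]) (auto simp: coeff_pCons split: nat.split)
  then show "A \<subseteq> adjoin A x" by auto
  show "x \<in> adjoin A x"
    unfolding adjoin_def using c by (intro CollectI exI[of _ "[:0, 1:]"]) (auto simp: coeff_pCons split: nat.split)
  show "subring_set (adjoin A x)"
    unfolding subring_set_def
  proof (intro conjI ballI)
    show "1 \<in> adjoin A x" using const c by simp
    fix u v assume "u \<in> adjoin A x" "v \<in> adjoin A x"
    then obtain p q where *: "u = poly p x" "v = poly q x" "\<forall>i. coeff p i \<in> A" "\<forall>i. coeff q i \<in> A"
      by (auto simp: adjoin_def)
    show "u - v \<in> adjoin A x"
      unfolding adjoin_def using * c by (intro CollectI exI[of _ "p - q"]) auto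
    show "u * v \<in> adjoin A x"
      unfolding adjoin_def using * c sum by (intro CollectI exI[of _ "p * q"]) (auto simp: coeff_mult)
  qed
qed

text \<open>
  Hilbert's basis theorem. Polynomials over \<open>A\<close> stand for their values at \<open>x\<close>, so \<open>T n J\<close> below
  consists of all representations of elements of \<open>J\<close> by polynomials of degree at most \<open>n\<close>.
\<close>

lemma noetherian_set_adjoin:
  assumes A: "noetherian_set A"
  shows "noetherian_set (adjoin A x)"
  unfolding noetherian_set_def
proof (intro conjI allI impI)
  have sA: "subring_set A" using A by (simp add: noetherian_set_def)
  note c = subring_set_closed[OF sA]
  show sAx: "subring_set (adjoin A x)" using subring_set_adjoin(1)[OF sA] .
  note Ax = subring_set_adjoin(2,3)[OF sA, of x]
  have gen: "\<exists>G. finite G \<and> G \<subseteq> J \<and> (\<forall>K. ideal_set A K \<longrightarrow> G \<subseteq> K \<longrightarrow> J \<subseteq> K)" if "ideal_set A J" for J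
    using A that by (simp add: noetherian_set_def)
  define T where "T n J = {q. (\<forall>i. coeff q i \<in> A) \<and> degree q \<le> n \<and> poly q x \<in> J}" for n J
  \<comment> \<open>Leading coefficients in degree \<open>n\<close>; lower degrees are allowed so
    that they form an ideal of \<open>A\<close>.\<close>
  define L where "L n J = (\<lambda>q. coeff q n) ` T n J" for n J
  have Ldiff: "p - q \<in> T n J" if "p \<in> T n J" "q \<in> T n J" "ideal_set (adjoin A x) J" for p q n J
    using that c by (auto simp: T_def intro!: degree_diff_le ideal_set_closed(3)[OF that(3)])
  have L: "ideal_set A (L n J)" if J: "ideal_set (adjoin A x) J" for n J
    unfolding ideal_set_def
  proof (intro conjI ballI)
    show "L n J \<subseteq> A" by (auto simp: L_def T_def)
    show "0 \<in> L n J" unfolding L_def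
      by (intro image_eqI[of _ _ 0]) (use c ideal_set_closed[OF J] in \<open>auto simp: T_def\<close>)
    show "a - b \<in> L n J" if "a \<in> L n J" "b \<in> L n J" for a b
    proof -
      obtain p q where "p \<in> T n J" "q \<in> T n J" "a = coeff p n" "b = coeff q n"
        using \<open>a \<in> L n J\<close> \<open>b \<in> L n J\<close> by (auto simp: L_def)
      then show ?thesis unfolding L_def
        by (intro image_eqI[of _ _ "p - q"] Ldiff J) auto
    qed
    show "a * b \<in> L n J" if ab: "a \<in> A" "b \<in> L n J" for a b
    proof -
      obtain q where q: "q \<in> T n J" "b = coeff q n" using ab by (auto simp: L_def)
      have "smult a q \<in> T n J"
        using q ab c Ax ideal_set_closed(5)[OF J, of a "poly q x"]
        by (auto simp: T_def intro: order_trans[OF degree_smult_le])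
      then show ?thesis unfolding L_def using q by (intro image_eqI[of _ _ "smult a q"]) auto
    qed
  qed
  have shift: "monom 1 k * q \<in> T (n + k) J" if "q \<in> T n J" "ideal_set (adjoin A x) J" for q n k J
  proof -
    have "x ^ k \<in> adjoin A x"
      by (induction k) (use subring_set_closed[OF sAx] Ax in auto)
    then have "x ^ k * poly q x \<in> J" using that ideal_set_closed(5)[OF that(2)] by (auto simp: T_def)
    moreover have "degree (monom 1 k * q) \<le> n + k"
      using that degree_mult_le[of "monom (1::'a) k" q] degree_monom_le[of "1::'a" k] by (auto simp: T_def)
    ultimately show ?thesis
      using that c by (auto simp: T_def poly_monom coeff_monom_mult)
  qed
  fix J assume J: "ideal_set (adjoin A x) J"
  have mono: "L n J \<subseteq> L (n + k) J" for n k
  proof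
    fix a assume "a \<in> L n J"
    then obtain q where q: "q \<in> T n J" "a = coeff q n" by (auto simp: L_def)
    show "a \<in> L (n + k) J" unfolding L_def
      by (rule image_eqI[OF _ shift[OF q(1) J, of k]]) (simp add: q coeff_monom_mult)
  qed
  have mono': "L n J \<subseteq> L m J" if "n \<le> m" for n m
    using mono[of n "m - n"] that by simp
  \<comment> \<open>The union of the ascending chain is finitely generated, so the chain is constant
    from some \<open>m\<close> on.\<close>
  have U: "ideal_set A (\<Union>n. L n J)"
    unfolding ideal_set_def
  proof (intro conjI ballI)
    show "(\<Union>n. L n J) \<subseteq> A" using ideal_set_closed(1)[OF L[OF J]] by blast
    show "0 \<in> (\<Union>n. L n J)" using ideal_set_closed(2)[OF L[OF J]] by blast
    show "a - b \<in> (\<Union>n. L n J)" if ab: "a \<in> (\<Union>n. L n J)" "b \<in> (\<Union>n. L n J)" for a b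
    proof -
      obtain n m where "a \<in> L n J" "b \<in> L m J" using ab by auto
      then have "a \<in> L (max n m) J" "b \<in> L (max n m) J" using mono' by (meson max.cobounded1 max.cobounded2 subsetD)+
      then show ?thesis using ideal_set_closed(3)[OF L[OF J]] by blast
    qed
    show "a * b \<in> (\<Union>n. L n J)" if "a \<in> A" "b \<in> (\<Union>n. L n J)" for a b
      using that ideal_set_closed(5)[OF L[OF J]] by blast
  qed
  obtain G where G: "finite G" "G \<subseteq> (\<Union>n. L n J)" "\<And>K. ideal_set A K \<Longrightarrow> G \<subseteq> K \<Longrightarrow> (\<Union>n. L n J) \<subseteq> K"
    using gen[OF U] by blast
  have "\<exists>m. G \<subseteq> L m J" using G(1,2)
  proof (induction G)
    case (insert g G)
    then obtain n m where "g \<in> L n J" "G \<subseteq> L m J" by auto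
    then have "insert g G \<subseteq> L (max n m) J" using mono' by (meson insert_subset max.cobounded1 max.cobounded2 subset_trans subsetD)
    then show ?case by blast
  qed auto
  then obtain m where "G \<subseteq> L m J" by blast
  then have m: "L n J \<subseteq> L m J" for n using G(3)[OF L[OF J]] by blast
  have "\<forall>n. \<exists>S. finite S \<and> S \<subseteq> T n J \<and> (\<forall>K. ideal_set A K \<longrightarrow> (\<lambda>q. coeff q n) ` S \<subseteq> K \<longrightarrow> L n J \<subseteq> K)"
  proof
    fix n
    obtain S where "finite S" "S \<subseteq> L n J" "\<And>K. ideal_set A K \<Longrightarrow> S \<subseteq> K \<Longrightarrow> L n J \<subseteq> K"
      using gen[OF L[OF J]] by metis
    then show "\<exists>S. finite S \<and> S \<subseteq> T n J \<and> (\<forall>K. ideal_set A K \<longrightarrow> (\<lambda>q. coeff q n) ` S \<subseteq> K \<longrightarrow> L n J \<subseteq> K)"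
      using finite_subset_image[of S "\<lambda>q. coeff q n" "T n J"] unfolding L_def by metis
  qed
  then obtain S where S: "\<And>n. finite (S n)" "\<And>n. S n \<subseteq> T n J"
    "\<And>n K. ideal_set A K \<Longrightarrow> (\<lambda>q. coeff q n) ` S n \<subseteq> K \<Longrightarrow> L n J \<subseteq> K"
    by metis
  show "\<exists>H. finite H \<and> H \<subseteq> J \<and> (\<forall>K. ideal_set (adjoin A x) K \<longrightarrow> H \<subseteq> K \<longrightarrow> J \<subseteq> K)"
  proof (intro exI[of _ "\<Union>n\<le>m. (\<lambda>q. poly q x) ` S n"] conjI allI impI subsetI)
    show "finite (\<Union>n\<le>m. (\<lambda>q. poly q x) ` S n)" using S(1) by auto
    show "h \<in> J" if "h \<in> (\<Union>n\<le>m. (\<lambda>q. poly q x) ` S n)" for h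
      using that S(2) by (auto simp: T_def)
    fix K :: "'a set" and y assume K: "ideal_set (adjoin A x) K" "(\<Union>n\<le>m. (\<lambda>q. poly q x) ` S n) \<subseteq> K" and y: "y \<in> J"
    \<comment> \<open>It suffices that \<open>J\<close> and \<open>J \<inter> K\<close> have the
      same leading coefficients in every degree: up to \<open>m\<close> by the choice of
      \<open>S\<close>, beyond \<open>m\<close> by shifting.\<close>
    have JK: "ideal_set (adjoin A x) (J \<inter> K)"
      using J K(1) by (auto simp: ideal_set_def)
    have LK: "L n J \<subseteq> L n (J \<inter> K)" if "n \<le> m" for n
    proof (rule S(3)[OF L[OF JK]])
      have "S n \<subseteq> T n (J \<inter> K)" using S(2)[of n] K(2) that by (fastforce simp: T_def)
      then show "(\<lambda>q. coeff q n) ` S n \<subseteq> L n (J \<inter> K)" by (auto simp: L_def)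
    qed
    have LK': "L n J \<subseteq> L n (J \<inter> K)" for n
    proof (cases "n \<le> m")
      case False
      show ?thesis
      proof
        fix a assume "a \<in> L n J"
        then have "a \<in> L m (J \<inter> K)" using m LK[of m] by blast
        then obtain q where q: "q \<in> T m (J \<inter> K)" "a = coeff q m" by (auto simp: L_def)
        have "monom 1 (n - m) * q \<in> T n (J \<inter> K)" using shift[OF q(1) JK, of "n - m"] False by simp
        then show "a \<in> L n (J \<inter> K)" unfolding L_def
          by (rule image_eqI[rotated]) (use False in \<open>simp add: q coeff_monom_mult\<close>)
      qed
    qed (use LK in auto)
    \<comment> \<open>Subtracting a representative of an element of \<open>J \<inter> K\<close> with
      the same coefficient in degree \<open>n\<close> lowers the degree and stays over
      \<open>J\<close>.\<close>
    have key: "poly q x \<in> K" if "q \<in> T n J" for n q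
      using that
    proof (induction n arbitrary: q)
      case 0
      then have "coeff q 0 \<in> L 0 J" unfolding L_def by (rule imageI)
      then have "coeff q 0 \<in> L 0 (J \<inter> K)" using LK' by blast
      then obtain r where r: "r \<in> T 0 (J \<inter> K)" "coeff q 0 = coeff r 0" by (auto simp: L_def)
      then have "degree q = 0" "degree r = 0" using 0 by (auto simp: T_def)
      then have "q = r" using r(2) by (metis degree_0_id)
      then show ?case using r by (auto simp: T_def)
    next
      case (Suc n)
      have "coeff q (Suc n) \<in> L (Suc n) J" unfolding L_def using Suc.prems by (rule imageI)
      then have "coeff q (Suc n) \<in> L (Suc n) (J \<inter> K)" using LK' by blast
      then obtain r where r: "r \<in> T (Suc n) (J \<inter> K)" "coeff q (Suc n) = coeff r (Suc n)" by (auto simp: L_def)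
      then have rJ: "r \<in> T (Suc n) J" by (auto simp: T_def)
      have "degree (q - r) \<le> n"
      proof (intro degree_le allI impI)
        fix i assume "n < i"
        then consider "i = Suc n" | "i > Suc n" by linarith
        then show "coeff (q - r) i = 0"
          using Suc.prems r by cases (auto simp: T_def coeff_eq_0)
      qed
      then have "q - r \<in> T n J" using Ldiff[OF Suc.prems rJ J] by (auto simp: T_def)
      then have "poly (q - r) x \<in> K" by (rule Suc.IH)
      moreover have "poly r x \<in> K" using r by (auto simp: T_def)
      ultimately show ?case using ideal_set_closed(4)[OF K(1), of "poly (q - r) x" "poly r x"] by simp
    qed
    obtain q where "y = poly q x" "\<forall>i. coeff q i \<in> A"
      using y ideal_set_closed(1)[OF J] by (auto simp: adjoin_def)
    then show "y \<in> K" using key[of q "degree q"] y by (auto simp: T_def)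
  qed
qed

text \<open>The generators are adjoined to the image of the integers one at a time; the resulting
  noetherian subring contains all that they generate.\<close>

lemma noetherian_finitely_generated_ring:
  assumes "finitely_generated_ring (ring_of_type_algebra :: 'a::comm_ring_1 ring)"
  shows "noetherian_set (UNIV :: 'a set)"
proof -
  let ?R = "ring_of_type_algebra :: 'a ring"
  interpret cring ?R by (rule cring_from_type_algebra)
  obtain S where S: "finite S" "generate_ring ?R S = UNIV"
    using assms by (auto simp: finitely_generated_ring_def ring_of_type_algebra_def)
  have "\<exists>A. noetherian_set A \<and> S \<subseteq> A" using S(1)
  proof (induction S)
    case empty
    then show ?case using noetherian_set_range_of_int by blast
  next
    case (insert x S)
    then obtain A where "noetherian_set A" "S \<subseteq> A" by blast
    then show ?case
      using noetherian_set_adjoin[of A x] subring_set_adjoin[of A x]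
      by (intro exI[of _ "adjoin A x"]) (auto simp: noetherian_set_def[of A])
  qed
  then obtain A where A: "noetherian_set A" "S \<subseteq> A" by blast
  have sA: "subring_set A" using A(1) by (simp add: noetherian_set_def)
  have "x \<in> A" if "x \<in> generate_ring ?R S" for x
    using that
  proof induction
    case one
    then show ?case using subring_set_closed(2)[OF sA] by (simp add: ring_of_type_algebra_def)
  next
    case (incl h)
    then show ?case using A by auto
  next
    case (a_inv h)
    have "h \<oplus>\<^bsub>?R\<^esub> (\<ominus>\<^bsub>?R\<^esub> h) = \<zero>\<^bsub>?R\<^esub>"
      by (rule r_neg) (simp add: ring_of_type_algebra_def)
    then have "\<ominus>\<^bsub>?R\<^esub> h = - h" by (simp add: ring_of_type_algebra_def add_eq_0_iff)
    then show ?case using a_inv subring_set_closed(3)[OF sA] by simp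
  qed (use subring_set_closed[OF sA] in \<open>auto simp: ring_of_type_algebra_def\<close>)
  then have "A = UNIV" using S(2) by auto
  then show ?thesis using A(1) by simp
qed

text \<open>If all of them divided \<open>c\<close>, then so would the product of any
  \<open>n\<close> of them, with cofactor \<open>d n\<close>. The principal ideals of the
  \<open>d n\<close> would ascend strictly, against the noetherian property.\<close>

lemma exists_prime_not_dvd:
  fixes c :: "'a::idom"
  assumes fg: "finitely_generated_ring (ring_of_type_algebra :: 'a ring)"
    and P: "infinite P" "\<And>p. p \<in> P \<Longrightarrow> prime_elem p" "pairwise (\<lambda>p q. \<not> associates p q) P"
    and c: "c \<noteq> 0"
  shows "\<exists>p\<in>P. \<not> p dvd c"
proof (rule ccontr)
  assume "\<not> ?thesis"
  then have dvd: "p dvd c" if "p \<in> P" for p using that by blast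
  obtain f :: "nat \<Rightarrow> 'a" where f: "inj f" "range f \<subseteq> P"
    using P(1) infinite_countable_subset by blast
  have fp: "prime_elem (f n)" for n using f P(2) by auto
  have nd: "\<not> f m dvd f n" if "m \<noteq> n" for m n
  proof
    assume d: "f m dvd f n"
    then obtain u where u: "f n = f m * u" by (elim dvdE)
    \<comment> \<open>If \<open>f n\<close> divides \<open>f m\<close>, the two are associate; if it
      divides \<open>u\<close>, then \<open>f m\<close> is a unit.\<close>
    then have "f n dvd f m \<or> f n dvd u" by (metis dvd_refl prime_elem_dvd_multD[OF fp])
    moreover have "\<not> f n dvd u"
    proof
      assume "f n dvd u"
      then obtain v where "u = f n * v" by (elim dvdE)
      then have "f n * 1 = f n * (f m * v)" using u by (metis mult.left_commute mult_1_right)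
      moreover have "f n \<noteq> 0" using fp[of n] by (simp add: prime_elem_def)
      ultimately have "f m * v = 1" by (metis mult_cancel_left)
      then have "f m dvd 1" by (metis dvdI)
      then show False using fp[of m] by (simp add: prime_elem_def)
    qed
    ultimately have "associates (f m) (f n)" using d by (auto simp: associates_def)
    moreover have "f m \<noteq> f n" using f(1) that by (auto dest: injD)
    ultimately show False using P(3) f(2) unfolding pairwise_def by (meson rangeI subsetD)
  qed
  have prod: "(\<Prod>i<n. f i) dvd c" for n
  proof (induction n)
    case (Suc n)
    then obtain d where d: "c = (\<Prod>i<n. f i) * d" by (elim dvdE)
    have "f n dvd (\<Prod>i<n. f i) * d" using dvd[of "f n"] f(2) d by auto
    moreover have "\<not> f n dvd (\<Prod>i<n. f i)"
    proof -
      have "\<not> f n dvd (\<Prod>i<m. f i)" if "m \<le> n" for m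
        using that
      proof (induction m)
        case 0
        then show ?case using fp[of n] by (simp add: prime_elem_def)
      next
        case (Suc m)
        then show ?case using prime_elem_dvd_multD[OF fp] nd[of n m] by fastforce
      qed
      then show ?thesis by simp
    qed
    ultimately have "f n dvd d" using prime_elem_dvd_multD[OF fp] by blast
    then show ?case using d by (auto simp: mult_dvd_mono)
  qed auto
  then have "\<forall>n. \<exists>d. c = (\<Prod>i<n. f i) * d" by (simp add: dvd_def)
  then obtain d where d: "\<And>n. c = (\<Prod>i<n. f i) * d n" by (auto dest!: choice)
  have dS: "d n = f n * d (Suc n)" for n
  proof -
    have "(\<Prod>i<n. f i) * d n = (\<Prod>i<n. f i) * (f n * d (Suc n))"
      unfolding d[of n, symmetric] by (subst d[of "Suc n"]) (simp add: mult.assoc)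
    moreover have "(\<Prod>i<n. f i) \<noteq> 0" using c d[of n] by auto
    ultimately show ?thesis by simp
  qed
  have dle1: "d (Suc n) dvd d n" for n
    by (subst dS[of n]) (rule dvd_triv_right)
  have dle: "d m dvd d n" if "n \<le> m" for n m
    using that
  proof (induction rule: dec_induct)
    case (step k)
    show ?case by (rule dvd_trans[OF dle1 step.IH])
  qed simp
  define J where "J = {y. \<exists>n. d n dvd y}"
  have "x - y \<in> J" if xy: "x \<in> J" "y \<in> J" for x y
  proof -
    obtain n m where "d n dvd x" "d m dvd y" using xy by (auto simp: J_def)
    then have "d (max n m) dvd x" "d (max n m) dvd y"
      using dle[of n "max n m"] dle[of m "max n m"] by (simp_all add: dvd_trans[of "d (max n m)"])
    then show ?thesis unfolding J_def using dvd_diff by blast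
  qed
  then have "ideal_set UNIV J"
    unfolding ideal_set_def by (auto simp: J_def intro: dvd_mult)
  then obtain G where G: "finite G" "G \<subseteq> J" "\<And>K. ideal_set UNIV K \<Longrightarrow> G \<subseteq> K \<Longrightarrow> J \<subseteq> K"
    using noetherian_finitely_generated_ring[OF fg] by (auto simp: noetherian_set_def)
  have "\<exists>n. \<forall>g\<in>G. d n dvd g" using G(1,2)
  proof (induction G)
    case (insert g G)
    then obtain n m where "d n dvd g" "\<forall>g\<in>G. d m dvd g" by (auto simp: J_def)
    then have "\<forall>h\<in>insert g G. d (max n m) dvd h"
      using dle[of n "max n m"] dle[of m "max n m"] by (auto simp: dvd_trans[of "d (max n m)"])
    then show ?case by blast
  qed auto
  then obtain n where n: "\<forall>g\<in>G. d n dvd g" by blast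
  have "J \<subseteq> {y. d n dvd y}"
    by (rule G(3)) (use n in \<open>auto simp: ideal_set_def intro: dvd_diff dvd_mult\<close>)
  \<comment> \<open>The chain has stopped: \<open>d n\<close> divides \<open>d (Suc n)\<close>,
    while \<open>d n = f n * d (Suc n)\<close>, so \<open>f n\<close> would be a unit.\<close>
  moreover have "d (Suc n) \<in> J" unfolding J_def using dvd_refl by blast
  ultimately obtain u where "d (Suc n) = d n * u" by (auto elim: dvdE)
  then have "d (Suc n) * 1 = d (Suc n) * (f n * u)" using dS[of n] by (simp add: mult_ac)
  moreover have "d (Suc n) \<noteq> 0" using c d[of "Suc n"] by auto
  ultimately have "f n * u = 1" by simp
  then have "f n dvd 1" by (metis dvdI)
  then show False using fp[of n] by (simp add: prime_elem_def)
qed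

section \<open>The orbit of the pencil\<close>

text \<open>Clearing a common denominator \<open>f ^ k\<close> turns the determinant into
  \<open>f ^ (2 * k)\<close>, so \<open>prime_pencil_degree\<close> applies with
  \<open>M = 2 * k\<close>. The resulting powers of \<open>\<nu> F\<close> cancel, and of two norms
  with product at least 1 one is at least 1.\<close>

lemma pencil_norm_ge_1:
  fixes f :: "'a::idom poly poly" and P :: "'a poly poly fract ^ 2 ^ 2"
  assumes f: "f \<noteq> 0" "\<And>j. degree (coeff f j) < N"
    and p: "prime_elem p" "\<not> p dvd lead_coeff (lead_coeff f)"
    and \<nu>: "nonarch_norm \<nu>"
      "\<And>q. \<nu> (to_fract q) = (if weight_hom N q = 0 then 0 else 2 ^ degree (weight_hom N q))"
    and P: "det P = 1" "\<And>i j. P $ i $ j \<in> localization f"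
  shows "\<exists>i. \<nu> ((vector [to_fract [:[:p:]:], to_fract [:- monom 1 N, 1:]] v* P) $ i) \<ge> 1"
proof -
  interpret nonarch_norm \<nu> by fact
  interpret \<phi>: comm_ring_hom_map "weight_hom N" by (rule comm_ring_hom_map_weight_hom)
  define F w where "F = to_fract f" and "w = vector [to_fract [:[:p:]:], to_fract [:- monom 1 N, 1:]] v* P"
  obtain A k where A: "\<And>i j. P $ i $ j * F ^ k = to_fract (A i j)"
    using localization_common_denominator[OF P(2)] unfolding F_def by metis
  have "to_fract (A 1 1 * A 2 2 - A 1 2 * A 2 1) = det P * F ^ (2 * k)"
    unfolding mult_2 power_add by (simp add: det_2 algebra_simps flip: A)
  also have "\<dots> = to_fract (f ^ (2 * k))" using P(1) by (simp add: F_def to_fract_power)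
  finally have det: "A 1 1 * A 2 2 - A 1 2 * A 2 1 = f ^ (2 * k)"
    by (simp only: to_fract_eq_iff)
  define a where "a j = [:[:p:]:] * A 1 j + [:- monom 1 N, 1:] * A 2 j" for j
  have wa: "w $ j * F ^ k = to_fract (a j)" for j
    by (simp add: w_def a_def vector_matrix_mult_2 distrib_right mult.assoc A del: mult_pCons_left)
  have \<phi>a: "weight_hom N (a j) = [:[:p:]:] * weight_hom N (A 1 j) + monom [:0, 1:] N * weight_hom N (A 2 j)" for j
    unfolding a_def by (simp del: mult_pCons_left)
  have d: "weight_hom N (A 1 1) * weight_hom N (A 2 2) - weight_hom N (A 1 2) * weight_hom N (A 2 1) = weight_hom N f ^ (2 * k)"
    using arg_cong[OF det, of "weight_hom N"] by simp
  have lc: "\<not> p dvd coeff (lead_coeff (weight_hom N f)) 0"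
    using p(2) lead_coeff_weight_hom[OF f] by simp
  note deg = prime_pencil_degree[OF d p(1) lc \<phi>a \<phi>a]
  have "\<nu> (w $ 1) * \<nu> (w $ 2) * \<nu> F ^ (2 * k) = \<nu> (w $ 1 * F ^ k) * \<nu> (w $ 2 * F ^ k)"
    by (simp add: mult power mult_2 power_add)
  also have "\<dots> = 2 ^ (degree (weight_hom N (a 1)) + degree (weight_hom N (a 2)))"
    unfolding wa \<nu>(2) using deg(1,2) by (simp add: power_add)
  also have "\<dots> \<ge> 2 ^ (2 * k * degree (weight_hom N f))"
    using deg(3) by (intro power_increasing) auto
  also have "(2::real) ^ (2 * k * degree (weight_hom N f)) = \<nu> F ^ (2 * k)"
    using f(1) by (simp add: F_def \<nu>(2) flip: power_mult)
  finally have "\<nu> F ^ (2 * k) * 1 \<le> \<nu> F ^ (2 * k) * (\<nu> (w $ 1) * \<nu> (w $ 2))"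
    by (simp add: mult_ac)
  moreover have "\<nu> F ^ (2 * k) > 0" using f(1) by (simp add: F_def)
  ultimately have "1 \<le> \<nu> (w $ 1) * \<nu> (w $ 2)" by (simp only: mult_le_cancel_left_pos)
  then have "\<nu> (w $ 1) \<ge> 1 \<or> \<nu> (w $ 2) \<ge> 1"
    using mult_le_one[of "\<nu> (w $ 1)" "\<nu> (w $ 2)"] mult_strict_mono[of "\<nu> (w $ 1)" 1 "\<nu> (w $ 2)" 1]
    by (smt (verit) nonneg mult_cancel_right1)
  then show ?thesis unfolding w_def by blast
qed

theorem theorem1p2:
  fixes \<Gamma> :: "('r::idom poly poly fract ^ 2 ^ 2) set"
  assumes "finitely_generated_ring (ring_of_type_algebra :: 'r ring)"
    and "\<exists>P :: 'r set. infinite P \<and> (\<forall>p\<in>P. prime_elem p) \<and>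
           pairwise (\<lambda>p q. \<not> associates p q) P"
    and "subgroup \<Gamma> SL2"
    and "SL2_in_fract \<subseteq> \<Gamma>"
  shows "\<not> finitely_generated_group (SL2\<lparr>carrier := \<Gamma>\<rparr>)"
proof
  assume fg: "finitely_generated_group (SL2\<lparr>carrier := \<Gamma>\<rparr>)"
  obtain f where f: "f \<noteq> 0" "\<And>P i j. P \<in> \<Gamma> \<Longrightarrow> P $ i $ j \<in> localization f"
    using finitely_generated_subgroup_localization[OF assms(3) fg] by metis
  obtain p where p: "prime_elem p" "\<not> p dvd lead_coeff (lead_coeff f)"
    using exists_prime_not_dvd[OF assms(1), of _ "lead_coeff (lead_coeff f)"] assms(2) f(1)
    by (metis leading_coeff_0_iff)
  \<comment> \<open>The sum bounds every degree in \<open>s\<close>, and \<open>Suc\<close> makes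
    the bound strict.\<close>
  define N where "N = Suc (\<Sum>j\<le>degree f. degree (coeff f j))"
  have N: "degree (coeff f j) < N" for j
  proof (cases "j \<le> degree f")
    case True
    then show ?thesis unfolding N_def by (intro le_imp_less_Suc member_le_sum) auto
  qed (simp add: N_def coeff_eq_0)
  obtain \<nu> :: "'r poly poly fract \<Rightarrow> real" where \<nu>: "nonarch_norm \<nu>"
    "\<And>q. \<nu> (to_fract q) = (if weight_hom N q = 0 then 0 else 2 ^ degree (weight_hom N q))"
    using nonarch_norm_fract[OF nonarch_norm_comp[OF nonarch_norm_degree comm_ring_hom_map_weight_hom]]
    by (metis weight_hom_eq_0_iff)
  interpret \<phi>: comm_ring_hom_map "weight_hom N :: 'r poly poly \<Rightarrow> _" by (rule comm_ring_hom_map_weight_hom)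
  define \<pi> h :: "'r poly poly" where "\<pi> = [:[:p:]:]" and "h = [:- monom 1 N, 1:]"
  define w z :: "'r poly poly fract ^ 2" where "w = vector [to_fract \<pi>, to_fract h]" and "z = vector [1, 0]"
  have det: "det P = 1" if "P \<in> \<Gamma>" for P
    using subgroup.subset[OF assms(3)] that by (auto simp: SL2_def)
  have "\<exists>i. \<nu> ((w v* P) $ i) \<ge> 1" if "P \<in> \<Gamma>" for P
    unfolding w_def \<pi>_def h_def using pencil_norm_ge_1[OF f(1) N p \<nu> det[OF that] f(2)[OF that]] .
  then obtain B where B: "\<And>P x. P \<in> \<Gamma> \<Longrightarrow> w v* P = w \<Longrightarrow> z v* P = z + x *s w \<Longrightarrow> \<nu> x \<le> B"
    using unipotent_translation_bounded[OF \<nu>(1) assms(3) fg] by metis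
  have "2 ^ n \<le> B" for n
  proof -
    define r :: "'r poly poly" where "r = [:monom 1 n:]"
    \<comment> \<open>This is \<open>1 + r (h, -\<pi>)\<^sup>T (\<pi>, h)\<close>. It fixes
      \<open>w\<close> because \<open>w\<close> annihilates the column, and it moves
      \<open>z\<close> by \<open>r * h\<close> times \<open>w\<close>; the choice
      \<open>r = s ^ n\<close> makes these translations unbounded.\<close>
    define M :: "'r poly poly ^ 2 ^ 2"
      where "M = vector [vector [1 + r * h * \<pi>, r * h * h], vector [- (r * \<pi> * \<pi>), 1 - r * \<pi> * h]]"
    define P where "P = map_matrix to_fract M"
    have "det M = 1" by (simp add: M_def det_2 algebra_simps)
    then have P: "P \<in> \<Gamma>" using assms(4) by (auto simp: P_def SL2_in_fract_def SL2_def)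
    have "w v* P = w"
      by (simp add: vec_eq_iff forall_2 vector_matrix_mult_2 w_def P_def M_def algebra_simps)
    moreover have "z v* P = z + to_fract (r * h) *s w"
      by (simp add: vec_eq_iff forall_2 vector_matrix_mult_2 w_def z_def P_def M_def algebra_simps)
    ultimately have "\<nu> (to_fract (r * h)) \<le> B" by (rule B[OF P])
    have rh: "weight_hom N (r * h) = monom [:0, 1:] (n + N)"
      unfolding \<phi>.mult r_def h_def weight_hom_monom weight_hom_diff_monom mult_monom by simp
    have "2 ^ n \<le> (2 :: real) ^ (n + N)" by (intro power_increasing) auto
    also have "\<dots> = \<nu> (to_fract (r * h))"
      unfolding \<nu>(2) rh by (simp add: degree_monom_eq)
    also have "\<dots> \<le> B" by fact
    finally show ?thesis .
  qed
  moreover obtain n where "B < 2 ^ n" using real_arch_pow[of 2 B] by auto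
  ultimately show False using not_less by blast
qed

end
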